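(* Let $p,q$ be positive integers. Both the linear optimization problem over the set of $\prec$-maximal (with respect to $\mathfrak{C}_q$) $0/1$-matrices of size $p\times q$ with at most one $1$-entry per row, and the linear optimization problem over the set of $\prec$-maximal (with respect to $\mathfrak{C}_q$) $0/1$-matrices of size $p\times q$ with exactly one $1$-entry per row, can be solved in time $O(pq)$.
   Context: Notation: $[n]=\{1,\dots,n\}$. $\mathfrak{C}_q$ is the cyclic group of all $q$ cyclic permutations of $[q]$, acting on $0/1$-matrices of size $p\times q$ by permuting columns. Let $\prec$ be the lexicographic order on $\{0,1\}^{[p]\times[q]}$ with respect to the row-wise ordering $(1,1)<(1,2)<\dots<(1,q)<(2,1)<\dots<(p,q)$ of positions, i.e. $A\prec B$ iff $a_{k\ell}<b_{k\ell}$ at the first position $(k,\ell)$ where $A,B$ differ. A matrix is $\prec$-maximal with respect to $\mathfrak{C}_q$ if it is the $\prec$-maximum of its $\mathfrak{C}_q$-orbit. The linear optimization problem over a set $X$ of such matrices: given $c\in\mathbb{Q}^{[p]\times[q]}$, find $A^\star\in X$ maximizing $\langle c,A\rangle=\sum_{i=1}^p\sum_{j=1}^q c_{ij}A_{ij}$ over $A\in X$. Running times are counted in the unit-cost (arithmetic operation) model. *)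

theory Defs
  imports Complex_Main "HOL-Library.FuncSet"
begin

section \<open>Lexicographically maximal 0/1-matrices\<close>

text \<open>A \<open>p \<times> q\<close> matrix is an extensional function on \<open>{1..p} \<times> {1..q}\<close>.\<close>

type_synonym rmat = "nat \<times> nat \<Rightarrow> rat"

definition positions :: "nat \<Rightarrow> nat \<Rightarrow> (nat \<times> nat) set" where
  "positions p q = {1..p} \<times> {1..q}"

definition zero_one_matrices :: "nat \<Rightarrow> nat \<Rightarrow> rmat set" where
  "zero_one_matrices p q = positions p q \<rightarrow>\<^sub>E {0, 1}"

definition pos_less :: "nat \<times> nat \<Rightarrow> nat \<times> nat \<Rightarrow> bool" where
  "pos_less x y \<longleftrightarrow> fst x < fst y \<or> (fst x = fst y \<and> snd x < snd y)"

definition mat_less :: "nat \<Rightarrow> nat \<Rightarrow> rmat \<Rightarrow> rmat \<Rightarrow> bool" where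
  "mat_less p q A B \<longleftrightarrow>
     (\<exists>x\<in>positions p q. A x < B x \<and> (\<forall>y\<in>positions p q. pos_less y x \<longrightarrow> A y = B y))"

text \<open>The cyclic permutation of \<open>{1..q}\<close> that adds \<open>k\<close> modulo \<open>q\<close>; it is the identity
  outside \<open>{1..q}\<close>.\<close>

definition cyclic_perm :: "nat \<Rightarrow> nat \<Rightarrow> nat \<Rightarrow> nat" where
  "cyclic_perm q k j = (if j \<in> {1..q} then (j - 1 + k) mod q + 1 else j)"

definition cyclic_perms :: "nat \<Rightarrow> (nat \<Rightarrow> nat) set" where
  "cyclic_perms q = cyclic_perm q ` {..<q}"

text \<open>Indexing by \<open>\<sigma>\<close> rather than by its inverse makes no difference for orbits, as
  \<^const>\<open>cyclic_perms\<close> is closed under inverses.\<close>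

definition permute_columns :: "(nat \<Rightarrow> nat) \<Rightarrow> rmat \<Rightarrow> rmat" where
  "permute_columns \<sigma> A = (\<lambda>(i, j). A (i, \<sigma> j))"

definition cyclic_orbit :: "nat \<Rightarrow> rmat \<Rightarrow> rmat set" where
  "cyclic_orbit q A = (\<lambda>\<sigma>. permute_columns \<sigma> A) ` cyclic_perms q"

definition lex_maximal :: "nat \<Rightarrow> nat \<Rightarrow> rmat \<Rightarrow> bool" where
  "lex_maximal p q A \<longleftrightarrow> (\<forall>B\<in>cyclic_orbit q A. B = A \<or> mat_less p q B A)"

definition max_at_most_one :: "nat \<Rightarrow> nat \<Rightarrow> rmat set" where
  "max_at_most_one p q =
     {A \<in> zero_one_matrices p q. lex_maximal p q A \<and>
        (\<forall>i\<in>{1..p}. card {j \<in> {1..q}. A (i, j) = 1} \<le> 1)}"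

definition max_exactly_one :: "nat \<Rightarrow> nat \<Rightarrow> rmat set" where
  "max_exactly_one p q =
     {A \<in> zero_one_matrices p q. lex_maximal p q A \<and>
        (\<forall>i\<in>{1..p}. card {j \<in> {1..q}. A (i, j) = 1} = 1)}"

definition objective :: "nat \<Rightarrow> nat \<Rightarrow> rmat \<Rightarrow> rmat \<Rightarrow> rat" where
  "objective p q c A = (\<Sum>i = 1..p. \<Sum>j = 1..q. c (i, j) * A (i, j))"


section \<open>The arithmetic model: a unit-cost random access machine\<close>

text \<open>The machine has two sorts of storage. The natural-number part is used for control and
  addressing, the rational part holds the numerical data. Each part consists of registers, which
  instructions name directly, and of a memory, which is accessed through an address held in a
  natural-number register. Every instruction costs one time unit. There are no conversions
  between the two sorts, no rounding, and no multiplication of natural numbers, so that unit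
  costs cannot be exploited by packing data into large numbers.\<close>

datatype instr =
    NConst nat nat | NAdd nat nat nat | NSub nat nat nat
  | NLoad nat nat | NStore nat nat
  | QConst nat rat | QAdd nat nat nat | QSub nat nat nat | QMul nat nat nat | QDiv nat nat nat
  | QLoad nat nat | QStore nat nat
  | Jump nat | JumpNLe nat nat nat | JumpQLe nat nat nat

record state =
  pc :: nat
  nreg :: "nat \<Rightarrow> nat"
  nmem :: "nat \<Rightarrow> nat"
  qreg :: "nat \<Rightarrow> rat"
  qmem :: "nat \<Rightarrow> rat"

text \<open>The first argument is the destination register, except in stores, where it is the register
  holding the address, and in jumps, where the last argument is the target. \<open>NSub\<close> truncates at
  zero, and \<open>QDiv\<close> by zero yields zero.\<close>

fun exec :: "instr \<Rightarrow> state \<Rightarrow> state" where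
  "exec (NConst d n) s = s\<lparr>pc := pc s + 1, nreg := (nreg s)(d := n)\<rparr>"
| "exec (NAdd d a b) s = s\<lparr>pc := pc s + 1, nreg := (nreg s)(d := nreg s a + nreg s b)\<rparr>"
| "exec (NSub d a b) s = s\<lparr>pc := pc s + 1, nreg := (nreg s)(d := nreg s a - nreg s b)\<rparr>"
| "exec (NLoad d a) s = s\<lparr>pc := pc s + 1, nreg := (nreg s)(d := nmem s (nreg s a))\<rparr>"
| "exec (NStore a b) s = s\<lparr>pc := pc s + 1, nmem := (nmem s)(nreg s a := nreg s b)\<rparr>"
| "exec (QConst d x) s = s\<lparr>pc := pc s + 1, qreg := (qreg s)(d := x)\<rparr>"
| "exec (QAdd d a b) s = s\<lparr>pc := pc s + 1, qreg := (qreg s)(d := qreg s a + qreg s b)\<rparr>"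
| "exec (QSub d a b) s = s\<lparr>pc := pc s + 1, qreg := (qreg s)(d := qreg s a - qreg s b)\<rparr>"
| "exec (QMul d a b) s = s\<lparr>pc := pc s + 1, qreg := (qreg s)(d := qreg s a * qreg s b)\<rparr>"
| "exec (QDiv d a b) s = s\<lparr>pc := pc s + 1, qreg := (qreg s)(d := qreg s a / qreg s b)\<rparr>"
| "exec (QLoad d a) s = s\<lparr>pc := pc s + 1, qreg := (qreg s)(d := qmem s (nreg s a))\<rparr>"
| "exec (QStore a b) s = s\<lparr>pc := pc s + 1, qmem := (qmem s)(nreg s a := qreg s b)\<rparr>"
| "exec (Jump l) s = s\<lparr>pc := l\<rparr>"
| "exec (JumpNLe a b l) s = s\<lparr>pc := (if nreg s a \<le> nreg s b then l else pc s + 1)\<rparr>"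
| "exec (JumpQLe a b l) s = s\<lparr>pc := (if qreg s a \<le> qreg s b then l else pc s + 1)\<rparr>"

type_synonym program = "instr list"

definition halted :: "program \<Rightarrow> state \<Rightarrow> bool" where
  "halted P s \<longleftrightarrow> length P \<le> pc s"

definition step :: "program \<Rightarrow> state \<Rightarrow> state" where
  "step P s = (if halted P s then s else exec (P ! pc s) s)"

definition run :: "program \<Rightarrow> nat \<Rightarrow> state \<Rightarrow> state" where
  "run P t s = (step P ^^ t) s"

text \<open>Input convention: the natural-number registers 0 and 1 hold \<open>p\<close> and \<open>q\<close>, the rational memory
  cells \<open>0, \<dots>, pq - 1\<close> hold \<open>c\<close> row by row, and everything else is zero. Output convention: the
  matrix is stored row by row in the cells \<open>pq, \<dots>, 2pq - 1\<close>.\<close>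

definition input_state :: "nat \<Rightarrow> nat \<Rightarrow> rmat \<Rightarrow> state" where
  "input_state p q c =
     \<lparr>pc = 0,
      nreg = (\<lambda>_. 0)(0 := p, 1 := q),
      nmem = (\<lambda>_. 0),
      qreg = (\<lambda>_. 0),
      qmem = (\<lambda>a. if a < p * q then c (a div q + 1, a mod q + 1) else 0)\<rparr>"

definition output_matrix :: "nat \<Rightarrow> nat \<Rightarrow> state \<Rightarrow> rmat" where
  "output_matrix p q s =
     (\<lambda>(i, j) \<in> positions p q. qmem s (p * q + (i - 1) * q + (j - 1)))"

text \<open>One program has to work for all sizes and all objective functions. As sizes are positive, the
  O-bound is a uniform bound for all \<open>p\<close> and \<open>q\<close>, not only an asymptotic one.\<close>

definition linear_optimization_solvable_in_O ::
    "(nat \<Rightarrow> nat \<Rightarrow> rmat set) \<Rightarrow> (nat \<Rightarrow> nat \<Rightarrow> nat) \<Rightarrow> bool" where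
  "linear_optimization_solvable_in_O X f \<longleftrightarrow>
     (\<exists>P K. \<forall>p \<ge> 1. \<forall>q \<ge> 1. \<forall>c. \<exists>t \<le> K * f p q.
        halted P (run P t (input_state p q c)) \<and>
        is_arg_max (objective p q c) (\<lambda>A. A \<in> X p q)
          (output_matrix p q (run P t (input_state p q c))))"

end

theory Submission
  imports Defs
begin

text \<open>If every row has at most one 1-entry, a matrix is lexicographically maximal iff the 1-entry
  of its first nonzero row \<open>k\<close>, if there is one, is in column 1, because a cyclic shift moves this
  entry freely. Once \<open>k\<close> is chosen, the rows below it are independent of each other: each
  contributes its largest entry, or zero if that is better and the row may be empty. A backward scan
  of the rows keeps the sum of these contributions and the best choice of \<open>k\<close> so far; the chosen
  entries are written in a second pass. If every row has exactly one 1-entry, \<open>k\<close> is forced to be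
  the first row.\<close>

section \<open>Combinatorial optimality\<close>

definition row_ones :: "nat \<Rightarrow> rmat \<Rightarrow> nat \<Rightarrow> nat set" where
  "row_ones q A i = {j \<in> {1..q}. A (i, j) = 1}"

text \<open>The flag \<open>ex\<close> lets one proof cover both problems. It is a parameter of the
  program text, not an input of the machine.\<close>

definition max_matrices :: "bool \<Rightarrow> nat \<Rightarrow> nat \<Rightarrow> rmat set" where
  "max_matrices ex = (if ex then max_exactly_one else max_at_most_one)"

lemma mem_max_matrices:
  "A \<in> max_matrices ex p q \<longleftrightarrow> A \<in> zero_one_matrices p q \<and> lex_maximal p q A \<and>
     (\<forall>i\<in>{1..p}. card (row_ones q A i) \<le> 1 \<and> (ex \<longrightarrow> card (row_ones q A i) = 1))"
  by (auto simp: max_matrices_def max_exactly_one_def max_at_most_one_def row_ones_def)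

lemma zero_one_matrices_cases:
  assumes "A \<in> zero_one_matrices p q" "i \<in> {1..p}" "j \<in> {1..q}"
  shows "A (i, j) = 0 \<or> A (i, j) = 1"
  using assms by (auto simp: zero_one_matrices_def positions_def PiE_def Pi_def)

lemma finite_row_ones [simp]: "finite (row_ones q A i)"
  by (simp add: row_ones_def)

lemma mat_less_asym:
  assumes "mat_less p q A B"
  shows "\<not> mat_less p q B A"
proof
  assume "mat_less p q B A"
  then obtain y where y: "y \<in> positions p q" "B y < A y"
    "\<forall>z\<in>positions p q. pos_less z y \<longrightarrow> B z = A z"
    by (auto simp: mat_less_def)
  obtain x where x: "x \<in> positions p q" "A x < B x"
    "\<forall>z\<in>positions p q. pos_less z x \<longrightarrow> A z = B z"
    using assms by (auto simp: mat_less_def)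
  have "pos_less x y \<or> pos_less y x \<or> x = y"
    by (auto simp: pos_less_def prod_eq_iff)
  then show False
  proof (elim disjE)
    assume "pos_less x y"
    then show False using x(1,2) y(3) by force
  next
    assume "pos_less y x"
    then show False using x(3) y(1,2) by force
  next
    assume "x = y"
    then show False using x(2) y(2) by simp
  qed
qed

lemma cyclic_perm_in:
  assumes "j \<in> {1..q}"
  shows "cyclic_perm q k j \<in> {1..q}"
  using assms by (auto simp: cyclic_perm_def Suc_le_eq)

text \<open>A column shift keeps zero rows zero, so position \<open>(i, 1)\<close> in the first
  nonzero row \<open>i\<close> decides. Some shift brings the 1 of that row there, hence a maximal
  \<open>A\<close> already has it there. Conversely, a nontrivial shift moves another entry there,
  which is 0 because the row has only one 1.\<close>

lemma lex_maximal_iff: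
  assumes A: "A \<in> zero_one_matrices p q" and q: "q \<ge> 1"
    and card: "\<And>i. i \<in> {1..p} \<Longrightarrow> card (row_ones q A i) \<le> 1"
  shows "lex_maximal p q A \<longleftrightarrow>
    (\<forall>i\<in>{1..p}. row_ones q A i \<noteq> {} \<and> (\<forall>i'\<in>{1..<i}. row_ones q A i' = {}) \<longrightarrow> A (i, 1) = 1)"
proof (intro iffI ballI impI)
  fix i assume lm: "lex_maximal p q A" and i: "i \<in> {1..p}"
    and lead: "row_ones q A i \<noteq> {} \<and> (\<forall>i'\<in>{1..<i}. row_ones q A i' = {})"
  then obtain j where j: "j \<in> {1..q}" "A (i, j) = 1"
    by (auto simp: row_ones_def)
  \<comment> \<open>This shift sends column 1 to \<open>j\<close>, so that
    \<open>B (i, 1) = A (i, j)\<close>.\<close>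
  define B where "B = permute_columns (cyclic_perm q (j - 1)) A"
  have B_orb: "B \<in> cyclic_orbit q A"
    using j by (auto simp: B_def cyclic_orbit_def cyclic_perms_def)
  have B1: "B (i, 1) = 1"
    using j q by (auto simp: B_def permute_columns_def cyclic_perm_def)
  show "A (i, 1) = 1"
  proof (rule ccontr)
    assume "A (i, 1) \<noteq> 1"
    then have A1: "A (i, 1) = 0"
      using zero_one_matrices_cases[OF A i, of 1] q by auto
    have zero: "A (i', j') = 0" if "i' \<in> {1..<i}" "j' \<in> {1..q}" for i' j'
      using zero_one_matrices_cases[OF A, of i' j'] that lead i
      by (fastforce simp: row_ones_def)
    have "mat_less p q A B"
      unfolding mat_less_def
    proof (intro bexI[of _ "(i, 1)"] conjI ballI impI)
      show "A (i, 1) < B (i, 1)" using A1 B1 by simp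
      show "(i, 1) \<in> positions p q" using i q by (simp add: positions_def)
      fix y assume y: "y \<in> positions p q" "pos_less y (i, 1)"
      then show "A y = B y"
        using zero cyclic_perm_in[of "snd y" q "j - 1"]
        by (auto simp: positions_def pos_less_def B_def permute_columns_def)
    qed
    moreover have "B = A \<or> mat_less p q B A"
      using lm B_orb by (auto simp: lex_maximal_def)
    ultimately show False
      using A1 B1 mat_less_asym by fastforce
  qed
next
  assume lead: "\<forall>i\<in>{1..p}. row_ones q A i \<noteq> {} \<and> (\<forall>i'\<in>{1..<i}. row_ones q A i' = {})
    \<longrightarrow> A (i, 1) = 1"
  show "lex_maximal p q A"
    unfolding lex_maximal_def
  proof
    fix B assume "B \<in> cyclic_orbit q A"
    then obtain k where k: "k < q" and B: "B = permute_columns (cyclic_perm q k) A"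
      by (auto simp: cyclic_orbit_def cyclic_perms_def)
    \<comment> \<open>\<open>B = A\<close> is an equality of functions, so the values off the matrix
      have to agree too; there \<open>A\<close> is \<open>undefined\<close>, and the shift moves no
      position into or out of the matrix.\<close>
    have outside: "B y = A y" if "y \<notin> positions p q" for y
      using that A cyclic_perm_in[of "snd y" q k]
      by (cases y) (auto simp: B permute_columns_def positions_def zero_one_matrices_def
          PiE_def extensional_def cyclic_perm_def)
    show "B = A \<or> mat_less p q B A"
    proof (cases "\<exists>i. i \<in> {1..p} \<and> row_ones q A i \<noteq> {}")
      case False
      have "B y = A y" if "y \<in> positions p q" for y
      proof -
        have z: "A (i, j) = 0" if "i \<in> {1..p}" "j \<in> {1..q}" for i j
          using zero_one_matrices_cases[OF A that] that False by (auto simp: row_ones_def)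
        show ?thesis
          using that z cyclic_perm_in[of "snd y" q k]
          by (auto simp: B permute_columns_def positions_def)
      qed
      then show ?thesis using outside by (intro disjI1 ext) blast
    next
      case True
      define i where "i = (LEAST i. i \<in> {1..p} \<and> row_ones q A i \<noteq> {})"
      have i: "i \<in> {1..p}" "row_ones q A i \<noteq> {}"
        using LeastI_ex[OF True] by (auto simp: i_def)
      have before: "row_ones q A i' = {}" if "i' \<in> {1..<i}" for i'
        using not_less_Least[of i' "\<lambda>i. i \<in> {1..p} \<and> row_ones q A i \<noteq> {}", folded i_def]
          that i(1) by simp
      have A1: "A (i, 1) = 1" using lead i before by blast
      show ?thesis
      proof (cases "k = 0")
        case True
        then have "cyclic_perm q k = id" by (auto simp: cyclic_perm_def fun_eq_iff)
        then show ?thesis by (simp add: B permute_columns_def)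
      next
        case False
        have zero: "A (i', j') = 0" if "i' \<in> {1..<i}" "j' \<in> {1..q}" for i' j'
          using zero_one_matrices_cases[OF A, of i' j'] that before[of i'] i
          by (fastforce simp: row_ones_def)
        have k1: "cyclic_perm q k 1 = k + 1" using k q by (simp add: cyclic_perm_def)
        have "A (i, k + 1) \<noteq> 1"
        proof
          assume "A (i, k + 1) = 1"
          then have "{1, k + 1} \<subseteq> row_ones q A i" using A1 k by (auto simp: row_ones_def)
          then have "card {1, k + 1} \<le> card (row_ones q A i)" by (intro card_mono) auto
          then show False using card[OF i(1)] False by simp
        qed
        then have "A (i, k + 1) = 0"
          using zero_one_matrices_cases[OF A i(1), of "k + 1"] k by auto
        then have B1: "B (i, 1) = 0" using k1 by (simp add: B permute_columns_def)
        have "mat_less p q B A"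
          unfolding mat_less_def
        proof (intro bexI[of _ "(i, 1)"] conjI ballI impI)
          show "B (i, 1) < A (i, 1)" using A1 B1 by simp
          show "(i, 1) \<in> positions p q" using i q by (simp add: positions_def)
          fix y assume y: "y \<in> positions p q" "pos_less y (i, 1)"
          then show "B y = A y"
            using zero cyclic_perm_in[of "snd y" q k]
            by (auto simp: positions_def pos_less_def B permute_columns_def)
        qed
        then show ?thesis ..
      qed
    qed
  qed
qed

section \<open>Reduction to a leading row and one best cell per later row\<close>

definition input_mem :: "nat \<Rightarrow> nat \<Rightarrow> rmat \<Rightarrow> nat \<Rightarrow> rat" where
  "input_mem p q c a = (if a < p * q then c (a div q + 1, a mod q + 1) else 0)"

lemma input_mem_end [simp]: "input_mem p q c (p * q) = 0"
  by (simp add: input_mem_def)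

text \<open>The cell \<open>p * q\<close> holds zero and stands for a row without a 1-entry.\<close>

definition slots :: "bool \<Rightarrow> nat \<Rightarrow> nat \<Rightarrow> nat \<Rightarrow> nat set" where
  "slots ex p q r = (if ex then {} else {p * q}) \<union> {r * q..<r * q + q}"

text \<open>Possible indices, counted from 0, of the first nonzero row; \<open>p\<close> stands for the zero
  matrix.\<close>

definition leads :: "bool \<Rightarrow> nat \<Rightarrow> nat set" where
  "leads ex p = (if ex then {0} else {..p})"

text \<open>Entries are identified with their row-major addresses. The address \<open>p * q\<close>
  lies just outside the matrix, so an empty row and, through \<open>k = p\<close>, the zero matrix
  need no separate case.\<close>

definition choice_matrix :: "nat \<Rightarrow> nat \<Rightarrow> nat \<Rightarrow> (nat \<Rightarrow> nat) \<Rightarrow> rmat" where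
  "choice_matrix p q k x = (\<lambda>(i, j) \<in> positions p q.
     of_bool ((i - 1) * q + (j - 1) \<in> insert (k * q) (x ` {k<..<p})))"

definition choice_value :: "nat \<Rightarrow> nat \<Rightarrow> (nat \<Rightarrow> rat) \<Rightarrow> nat \<Rightarrow> (nat \<Rightarrow> nat) \<Rightarrow> rat" where
  "choice_value p q f k x = f (k * q) + (\<Sum>r\<in>{k<..<p}. f (x r))"

lemma address_less:
  fixes r p j q :: nat
  assumes "r < p" "j < q"
  shows "r * q + j < p * q"
proof -
  have "r * q + j < Suc r * q" using assms by simp
  also have "\<dots> \<le> p * q" using assms by (intro mult_right_mono) auto
  finally show ?thesis .
qed

lemma address_eq_iff:
  fixes r r' j j' q :: nat
  assumes "j < q" "j' < q"
  shows "r * q + j = r' * q + j' \<longleftrightarrow> r = r' \<and> j = j'"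
proof
  assume eq: "r * q + j = r' * q + j'"
  have "(r * q + j) div q = r" "(r' * q + j') div q = r'"
    using assms by (simp_all add: div_mult_self3)
  with eq show "r = r' \<and> j = j'" by auto
qed auto

lemma sum_Suc_interval: "(\<Sum>i = 1..n. g i) = (\<Sum>r<n. g (Suc r))"
  by (simp add: sum.atLeast1_atMost_eq)

lemma input_mem_address:
  assumes "r < p" "j < q"
  shows "input_mem p q c (r * q + j) = c (Suc r, Suc j)"
  using address_less[OF assms] assms by (simp add: input_mem_def)

definition row_value :: "nat \<Rightarrow> rmat \<Rightarrow> rmat \<Rightarrow> nat \<Rightarrow> rat" where
  "row_value q c A r = (\<Sum>j<q. c (Suc r, Suc j) * A (Suc r, Suc j))"

lemma objective_row_value: "objective p q c A = (\<Sum>r<p. row_value q c A r)"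
  by (simp only: objective_def sum_Suc_interval row_value_def)

lemma row_value_empty:
  assumes "A \<in> zero_one_matrices p q" "r < p" "row_ones q A (Suc r) = {}"
  shows "row_value q c A r = 0"
  unfolding row_value_def
proof (intro sum.neutral ballI)
  fix j assume "j \<in> {..<q}"
  then have "A (Suc r, Suc j) = 0"
    using zero_one_matrices_cases[OF assms(1), of "Suc r" "Suc j"] assms(2,3)
    by (auto simp: row_ones_def)
  then show "c (Suc r, Suc j) * A (Suc r, Suc j) = 0" by simp
qed

lemma row_value_single:
  assumes "A \<in> zero_one_matrices p q" "r < p" "row_ones q A (Suc r) = {Suc j}"
  shows "row_value q c A r = input_mem p q c (r * q + j)"
proof -
  have mem: "Suc j' \<in> row_ones q A (Suc r) \<longleftrightarrow> j' = j" for j'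
    using assms(3) by simp
  from mem[of j] have j: "j < q" "A (Suc r, Suc j) = 1" by (auto simp: row_ones_def)
  have "A (Suc r, Suc j') = of_bool (j' = j)" if "j' < q" for j'
    using zero_one_matrices_cases[OF assms(1), of "Suc r" "Suc j'"] assms(2) that mem[of j']
    by (auto simp: row_ones_def)
  then have "row_value q c A r = (\<Sum>j'<q. if j' = j then c (Suc r, Suc j') else 0)"
    unfolding row_value_def by (intro sum.cong) auto
  then show ?thesis using j assms(2) by (simp add: input_mem_address)
qed

text \<open>The upper bound on an arbitrary feasible matrix rests on this: each of its rows earns
  the value of one slot, hence at most that of the best slot.\<close>

lemma row_value_slot:
  assumes "A \<in> max_matrices ex p q" "r < p"
  obtains y where "y \<in> slots ex p q r" "row_value q c A r = input_mem p q c y"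
proof (cases "row_ones q A (Suc r) = {}")
  case True
  moreover have "\<not> ex"
  proof
    assume ex
    moreover have "Suc r \<in> {1..p}" using assms(2) by simp
    ultimately have "card (row_ones q A (Suc r)) = 1"
      using assms(1) unfolding mem_max_matrices by blast
    then show False using True by simp
  qed
  ultimately show ?thesis
    using assms row_value_empty[of A p q r c]
    by (intro that[of "p * q"]) (auto simp: slots_def mem_max_matrices)
next
  case False
  have "card (row_ones q A (Suc r)) \<le> 1" using assms by (auto simp: mem_max_matrices)
  with False have "card (row_ones q A (Suc r)) = 1"
    by (metis finite_row_ones card_0_eq le_antisym less_one not_le_imp_less)
  then obtain j' where j': "row_ones q A (Suc r) = {j'}" by (auto simp: card_1_singleton_iff)
  then have "j' \<in> {1..q}" by (auto simp: row_ones_def)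
  then obtain j where "j' = Suc j" "j < q" by (cases j') auto
  then show ?thesis
    using assms row_value_single[of A p q r j c] j'
    by (intro that[of "r * q + j"]) (auto simp: slots_def mem_max_matrices)
qed

text \<open>Slots of different rows share at most \<open>p * q\<close>, which is no cell of the
  matrix. So a cell of row \<open>r\<close> can only be hit by \<open>x r\<close>, or by
  \<open>k * q\<close> if it is the first cell of row \<open>k\<close>.\<close>

lemma choice_matrix_eq:
  assumes x: "\<And>r. r < p \<Longrightarrow> x r \<in> slots ex p q r" and rj: "r < p" "j < q" and "k \<le> p"
  shows "choice_matrix p q k x (Suc r, Suc j) = of_bool ((r = k \<and> j = 0) \<or> (k < r \<and> x r = r * q + j))"
proof -
  have "r * q + j = k * q \<longleftrightarrow> r = k \<and> j = 0"
    using address_eq_iff[of j q 0 r k] rj by auto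
  moreover have "r * q + j = x r' \<longleftrightarrow> r' = r \<and> x r = r * q + j" if r': "r' < p" for r'
  proof
    assume eq: "r * q + j = x r'"
    then have "x r' \<noteq> p * q" using address_less[OF rj] by auto
    then obtain j' where "x r' = r' * q + j'" "j' < q"
      using x[OF r'] by (auto simp: slots_def le_iff_add split: if_splits)
    then show "r' = r \<and> x r = r * q + j" using eq address_eq_iff[OF rj(2)] by metis
  qed auto
  then have "r * q + j \<in> x ` {k<..<p} \<longleftrightarrow> k < r \<and> x r = r * q + j"
    using rj by (auto simp: image_iff)
  ultimately show ?thesis
    using rj by (auto simp: choice_matrix_def positions_def)
qed

text \<open>The best slots \<open>x\<close> do not depend on the lead. A feasible matrix with first
  nonzero row \<open>k'\<close> earns nothing before \<open>k'\<close>, the entry of column 1 in row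
  \<open>k'\<close>, and at most the best slot in each later row. So \<open>choice_value\<close> at
  \<open>k'\<close> bounds it, and \<open>best\<close> passes from \<open>k'\<close> to
  \<open>k\<close>.\<close>

lemma is_arg_max_choice_matrix:
  assumes p: "p \<ge> 1" and q: "q \<ge> 1" and k: "k \<in> leads ex p"
    and x: "\<And>r. r < p \<Longrightarrow> is_arg_max (input_mem p q c) (\<lambda>a. a \<in> slots ex p q r) (x r)"
    and best: "\<And>k'. k' \<in> leads ex p \<Longrightarrow>
      choice_value p q (input_mem p q c) k' x \<le> choice_value p q (input_mem p q c) k x"
  shows "is_arg_max (objective p q c) (\<lambda>A. A \<in> max_matrices ex p q) (choice_matrix p q k x)"
proof -
  let ?f = "input_mem p q c" and ?A = "choice_matrix p q k x"
  have xs: "x r \<in> slots ex p q r" if "r < p" for r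
    using x[OF that] by (simp add: is_arg_max_def)
  have xmax: "?f y \<le> ?f (x r)" if "r < p" "y \<in> slots ex p q r" for r y
    using x[OF that(1)] that(2) by (auto simp: is_arg_max_def not_less)
  have kp: "k \<le> p" using k by (auto simp: leads_def split: if_splits)
  note eq = choice_matrix_eq[of p x ex q, OF xs _ _ kp]
  have A01: "?A \<in> zero_one_matrices p q"
    by (auto simp: zero_one_matrices_def choice_matrix_def)
  have mem: "Suc j \<in> row_ones q ?A (Suc r) \<longleftrightarrow>
      j < q \<and> ((r = k \<and> j = 0) \<or> (k < r \<and> x r = r * q + j))"
    if "r < p" for r j
    using that eq[of r j] by (auto simp: row_ones_def)
  have pos: "0 \<notin> row_ones q ?A i" for i by (simp add: row_ones_def)
  have rowI: "row_ones q ?A (Suc r) = Suc ` J"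
    if "r < p" "\<And>j. j \<in> J \<longleftrightarrow> j < q \<and> ((r = k \<and> j = 0) \<or> (k < r \<and> x r = r * q + j))" for r J
  proof (intro set_eqI)
    fix j show "j \<in> row_ones q ?A (Suc r) \<longleftrightarrow> j \<in> Suc ` J"
      using mem[OF that(1)] pos that(2) by (cases j) auto
  qed
  have row_lt: "row_ones q ?A (Suc r) = {}" if "r < p" "r < k" for r
    using rowI[of r "{}"] that by auto
  have row_eq: "row_ones q ?A (Suc k) = {Suc 0}" if "k < p"
  proof -
    have "j \<in> {0} \<longleftrightarrow> j < q \<and> ((k = k \<and> j = 0) \<or> (k < k \<and> x k = k * q + j))" for j
      using q by auto
    from rowI[OF that this] show ?thesis by simp
  qed
  have row_none: "row_ones q ?A (Suc r) = {}" if "r < p" "k < r" "x r = p * q" for r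
  proof -
    have "j \<in> {} \<longleftrightarrow> j < q \<and> ((r = k \<and> j = 0) \<or> (k < r \<and> x r = r * q + j))" for j
      using that address_less[OF that(1), of j q] by auto
    from rowI[OF that(1) this] show ?thesis by simp
  qed
  have row_gt: "row_ones q ?A (Suc r) = {Suc j}" if "r < p" "k < r" "x r = r * q + j" "j < q" for r j
  proof -
    have "j' \<in> {j} \<longleftrightarrow> j' < q \<and> ((r = k \<and> j' = 0) \<or> (k < r \<and> x r = r * q + j'))" for j'
      using that by auto
    from rowI[OF that(1) this] show ?thesis by simp
  qed
  have slotE: "(\<not> ex \<and> x r = p * q) \<or> (\<exists>j<q. x r = r * q + j)" if "r < p" for r
    using xs[OF that] by (auto simp: slots_def le_iff_add split: if_splits)
  have card: "card (row_ones q ?A (Suc r)) \<le> 1 \<and> (ex \<longrightarrow> card (row_ones q ?A (Suc r)) = 1)"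
    if "r < p" for r
  proof (cases r k rule: linorder_cases)
    case less
    moreover have "\<not> ex" using less k by (auto simp: leads_def split: if_splits)
    ultimately show ?thesis using row_lt[OF that] by simp
  next
    case equal
    then show ?thesis using row_eq that by simp
  next
    case greater
    from slotE[OF that] show ?thesis
    proof (elim disjE exE conjE)
      assume "\<not> ex" "x r = p * q"
      then show ?thesis using row_none[OF that greater] by simp
    next
      fix j assume "j < q" "x r = r * q + j"
      then show ?thesis using row_gt[OF that greater, of j] by simp
    qed
  qed
  have card': "card (row_ones q ?A i) \<le> 1 \<and> (ex \<longrightarrow> card (row_ones q ?A i) = 1)"
    if "i \<in> {1..p}" for i
    using card[of "i - 1"] that by auto
  have "lex_maximal p q ?A"
  proof (subst lex_maximal_iff[OF A01 q], goal_cases)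
    case (1 i) then show ?case using card' by blast
  next
    case 2
    show ?case
    proof (intro ballI impI)
      fix i assume i: "i \<in> {1..p}"
        "row_ones q ?A i \<noteq> {} \<and> (\<forall>i'\<in>{1..<i}. row_ones q ?A i' = {})"
      then obtain r where r: "i = Suc r" "r < p" by (cases i) auto
      have "\<not> r < k" using row_lt[of r] i r by auto
      \<comment> \<open>Otherwise row \<open>k\<close>, which contains a 1, would precede the first
        nonzero row.\<close>
      moreover have "\<not> k < r" using row_eq i r by force
      ultimately have "r = k" by simp
      then show "?A (i, 1) = 1" using eq[of r 0] r q by simp
    qed
  qed
  then have A_in: "?A \<in> max_matrices ex p q"
    using A01 card' by (simp add: mem_max_matrices)
  have split_sum: "sum g {..<p} = sum g {..<k'} + g k' + sum g {k'<..<p}"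
    if "k' < p" for k' and g :: "nat \<Rightarrow> rat"
  proof -
    have "{..<p} = {..<k'} \<union> {k'} \<union> {k'<..<p}" using that by auto
    also have "sum g \<dots> = sum g ({..<k'} \<union> {k'}) + sum g {k'<..<p}"
      by (rule sum.union_disjoint) auto
    also have "sum g ({..<k'} \<union> {k'}) = sum g {..<k'} + sum g {k'}"
      by (rule sum.union_disjoint) auto
    finally show ?thesis by simp
  qed
  have row_value_gt: "row_value q c ?A r = ?f (x r)" if "r < p" "k < r" for r
    using slotE[OF that(1)]
  proof (elim disjE exE conjE)
    assume "x r = p * q"
    then show ?thesis using row_value_empty[OF A01 that(1) row_none[OF that]] by simp
  next
    fix j assume "j < q" "x r = r * q + j"
    then show ?thesis using row_value_single[OF A01 that(1) row_gt[OF that]] by simp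
  qed
  have obj_A: "objective p q c ?A = choice_value p q ?f k x"
  proof (cases "k < p")
    case True
    have "row_value q c ?A k = ?f (k * q)"
      using row_value_single[OF A01 True row_eq[OF True]] by simp
    moreover have "(\<Sum>r<k. row_value q c ?A r) = 0"
      using True by (intro sum.neutral ballI row_value_empty[OF A01] row_lt) auto
    moreover have "(\<Sum>r\<in>{k<..<p}. row_value q c ?A r) = (\<Sum>r\<in>{k<..<p}. ?f (x r))"
      by (intro sum.cong row_value_gt) auto
    ultimately show ?thesis
      by (simp add: objective_row_value split_sum[OF True] choice_value_def)
  next
    case False
    then have "k = p" using kp by simp
    moreover have "(\<Sum>r<p. row_value q c ?A r) = 0"
      using \<open>k = p\<close> by (intro sum.neutral ballI row_value_empty[OF A01] row_lt) auto
    ultimately show ?thesis by (simp add: objective_row_value choice_value_def)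
  qed
  have "objective p q c A \<le> objective p q c ?A" if A: "A \<in> max_matrices ex p q" for A
  proof -
    have A01': "A \<in> zero_one_matrices p q" and lm: "lex_maximal p q A"
      and cardA: "\<And>i. i \<in> {1..p} \<Longrightarrow> card (row_ones q A i) \<le> 1"
      using A by (auto simp: mem_max_matrices)
    have lead: "A (i, 1) = 1" if "i \<in> {1..p}" "row_ones q A i \<noteq> {}"
      "\<forall>i'\<in>{1..<i}. row_ones q A i' = {}" for i
      using lex_maximal_iff[OF A01' q cardA] lm that by blast
    have "\<exists>k'\<in>leads ex p. objective p q c A \<le> choice_value p q ?f k' x"
    proof (cases "\<exists>r<p. row_ones q A (Suc r) \<noteq> {}")
      case True
      define k' where "k' = (LEAST r. r < p \<and> row_ones q A (Suc r) \<noteq> {})"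
      have k': "k' < p" "row_ones q A (Suc k') \<noteq> {}"
        using LeastI_ex[OF True] by (auto simp: k'_def)
      have before: "row_ones q A (Suc r) = {}" if "r < k'" for r
        using not_less_Least[of r "\<lambda>r. r < p \<and> row_ones q A (Suc r) \<noteq> {}", folded k'_def]
          that k'(1) by simp
      have before': "row_ones q A i = {}" if "i \<in> {1..<Suc k'}" for i
        using before[of "i - 1"] that by (cases i) auto
      have "A (Suc k', 1) = 1" using lead[of "Suc k'"] k' before' by simp
      then have "Suc 0 \<in> row_ones q A (Suc k')" using q by (simp add: row_ones_def)
      moreover have "card (row_ones q A (Suc k')) \<le> 1" using cardA k' by simp
      ultimately have "row_ones q A (Suc k') = {Suc 0}"
        by (auto simp: card_le_Suc0_iff_eq)
      then have vk: "row_value q c A k' = ?f (k' * q)"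
        using row_value_single[OF A01' k'(1), of 0 c] by simp
      have "row_value q c A r \<le> ?f (x r)" if "r < p" for r
        using row_value_slot[OF A that, of c] xmax[OF that] by metis
      then have "(\<Sum>r\<in>{k'<..<p}. row_value q c A r) \<le> (\<Sum>r\<in>{k'<..<p}. ?f (x r))"
        by (intro sum_mono) auto
      moreover have "(\<Sum>r<k'. row_value q c A r) = 0"
        using k' by (intro sum.neutral ballI row_value_empty[OF A01'] before) auto
      ultimately have "objective p q c A \<le> choice_value p q ?f k' x"
        by (simp add: objective_row_value split_sum[OF k'(1)] choice_value_def vk)
      \<comment> \<open>With exactly one 1 per row the first row is nonzero, which forces
        \<open>k' = 0\<close>.\<close>
      moreover have "k' \<in> leads ex p"
      proof (cases "ex \<and> k' \<noteq> 0")
        case True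
        then have "card (row_ones q A (Suc 0)) = 1"
          using A p by (auto simp: mem_max_matrices)
        then show ?thesis using before[of 0] True by simp
      next
        case False
        then show ?thesis using k' by (auto simp: leads_def)
      qed
      ultimately show ?thesis by blast
    next
      \<comment> \<open>Here \<open>A\<close> is zero: impossible if \<open>ex\<close>, and
        otherwise covered by the lead \<open>p\<close> of value 0.\<close>
      case False
      have "card (row_ones q A (Suc 0)) = 1" if ex
        using A p that by (auto simp: mem_max_matrices)
      then have "\<not> ex" using False p by (metis One_nat_def Suc_le_eq card.empty zero_neq_one)
      moreover have "(\<Sum>r<p. row_value q c A r) = 0"
        using False by (intro sum.neutral ballI row_value_empty[OF A01']) auto
      ultimately show ?thesis
        by (intro bexI[of _ p]) (auto simp: leads_def objective_row_value choice_value_def)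
    qed
    then show ?thesis using best obj_A by fastforce
  qed
  then show ?thesis using A_in by (auto simp: is_arg_max_def not_less)
qed

section \<open>Bounded reachability\<close>

text \<open>A total-correctness judgement with a time budget. As \<open>n\<close> is only an upper
  bound, branches of different length can share one budget.\<close>

definition reaches :: "program \<Rightarrow> nat \<Rightarrow> (state \<Rightarrow> bool) \<Rightarrow> state \<Rightarrow> bool" where
  "reaches P n Q s \<longleftrightarrow> (\<exists>t\<le>n. Q (run P t s))"

lemma run_0 [simp]: "run P 0 s = s"
  by (simp add: run_def)

lemma run_Suc: "run P (Suc t) s = run P t (step P s)"
  by (simp add: run_def funpow_swap1)

lemma run_numeral: "run P (numeral m) s = run P (pred_numeral m) (step P s)"
  by (simp add: numeral_eq_Suc run_Suc)

lemma run_add: "run P (t + u) s = run P u (run P t s)"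
  by (simp add: run_def add.commute[of t u] funpow_add)

lemma reachesI: "Q (run P t s) \<Longrightarrow> t \<le> n \<Longrightarrow> reaches P n Q s"
  by (auto simp: reaches_def)

lemma reaches_trans:
  assumes "reaches P m Q s" "\<And>s'. Q s' \<Longrightarrow> reaches P n R s'"
  shows "reaches P (m + n) R s"
proof -
  obtain t where t: "t \<le> m" "Q (run P t s)" using assms(1) by (auto simp: reaches_def)
  then obtain u where "u \<le> n" "R (run P u (run P t s))"
    using assms(2) by (auto simp: reaches_def)
  then show ?thesis using t by (intro reachesI[of R P "t + u"]) (auto simp: run_add)
qed

lemma reaches_mono: "reaches P m Q s \<Longrightarrow> m \<le> n \<Longrightarrow> reaches P n Q s"
  by (auto simp: reaches_def intro: order_trans)

text \<open>The index of \<open>I\<close> is the number of iterations still to come, so every loop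
  is seen as counting down.\<close>

lemma reaches_loop:
  assumes "\<And>n s. I (Suc n) s \<Longrightarrow> reaches P b (I n) s" and "I n s"
  shows "reaches P (n * b) (I 0) s"
  using assms(2)
proof (induction n arbitrary: s)
  case 0
  then show ?case by (intro reachesI[of _ _ 0]) auto
next
  case (Suc n)
  then show ?case using reaches_trans[OF assms(1) Suc.IH] by (simp add: add.commute)
qed

section \<open>The program\<close>

text \<open>Natural-number registers: 4 holds \<open>p * q\<close>, 5 the current cell, 6 the start of the current
  row, 7 the start of the best leading row, 8 the output address for the current row, 9 the value
  \<open>2 * p * q\<close>, which is the output address of the empty row. Rational registers: 0 holds the value
  of the current row, 1 the last entry read, 2 the best objective value, 3 the value of all rows
  below. The output addresses of the rows are kept in the natural-number memory. Empty rows and the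
  zero matrix make the second pass write to cell \<open>2 * p * q\<close>, just behind the output.\<close>

definition opt_prog :: "bool \<Rightarrow> program" where
  "opt_prog ex =
    [NConst 3 1,
     QConst 5 1,
     JumpNLe 0 2 6,
     NAdd 4 4 1,
     NSub 0 0 3,
     Jump 2,
     NAdd 5 4 2,
     NAdd 7 4 2,
     NAdd 9 4 4,
     JumpNLe 5 2 28,
     NSub 6 5 1,
     NSub 10 5 3,
     (if ex then QLoad 0 10 else QConst 0 0),
     (if ex then NAdd 8 10 4 else NAdd 8 9 2),
     JumpNLe 5 6 21,
     NSub 5 5 3,
     QLoad 1 5,
     JumpQLe 1 0 14,
     QLoad 0 5,
     NAdd 8 5 4,
     Jump 14,
     NStore 5 8,
     QAdd 4 1 3,
     QAdd 3 3 0,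
     JumpQLe 4 2 (if ex then 25 else 9),
     QAdd 2 4 6,
     NAdd 7 5 2,
     Jump 9,
     NAdd 10 7 4,
     QStore 10 5,
     NAdd 7 7 1,
     JumpNLe 4 7 35,
     NLoad 10 7,
     QStore 10 5,
     Jump 30]"

lemma length_opt_prog: "length (opt_prog ex) = 35"
  by (simp add: opt_prog_def)

text \<open>With \<open>pc\<close> known, execution becomes rewriting. Addresses 0 and 1 load
  constants, 2 to 5 build \<open>p * q\<close> by repeated addition, 6 to 8 prepare the scan, 9 to
  13 open a row, 14 to 20 scan it, 21 to 27 close it and revise the lead, and 28 to 34 write the
  result.\<close>

lemma nth_opt_prog:
  "opt_prog ex ! 0 = NConst 3 1"
  "opt_prog ex ! Suc 0 = QConst 5 1"
  "opt_prog ex ! 2 = JumpNLe 0 2 6"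
  "opt_prog ex ! 3 = NAdd 4 4 1"
  "opt_prog ex ! 4 = NSub 0 0 3"
  "opt_prog ex ! 5 = Jump 2"
  "opt_prog ex ! 6 = NAdd 5 4 2"
  "opt_prog ex ! 7 = NAdd 7 4 2"
  "opt_prog ex ! 8 = NAdd 9 4 4"
  "opt_prog ex ! 9 = JumpNLe 5 2 28"
  "opt_prog ex ! 10 = NSub 6 5 1"
  "opt_prog ex ! 11 = NSub 10 5 3"
  "opt_prog ex ! 12 = (if ex then QLoad 0 10 else QConst 0 0)"
  "opt_prog ex ! 13 = (if ex then NAdd 8 10 4 else NAdd 8 9 2)"
  "opt_prog ex ! 14 = JumpNLe 5 6 21"
  "opt_prog ex ! 15 = NSub 5 5 3"
  "opt_prog ex ! 16 = QLoad 1 5"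
  "opt_prog ex ! 17 = JumpQLe 1 0 14"
  "opt_prog ex ! 18 = QLoad 0 5"
  "opt_prog ex ! 19 = NAdd 8 5 4"
  "opt_prog ex ! 20 = Jump 14"
  "opt_prog ex ! 21 = NStore 5 8"
  "opt_prog ex ! 22 = QAdd 4 1 3"
  "opt_prog ex ! 23 = QAdd 3 3 0"
  "opt_prog ex ! 24 = JumpQLe 4 2 (if ex then 25 else 9)"
  "opt_prog ex ! 25 = QAdd 2 4 6"
  "opt_prog ex ! 26 = NAdd 7 5 2"
  "opt_prog ex ! 27 = Jump 9"
  "opt_prog ex ! 28 = NAdd 10 7 4"
  "opt_prog ex ! 29 = QStore 10 5"
  "opt_prog ex ! 30 = NAdd 7 7 1"
  "opt_prog ex ! 31 = JumpNLe 4 7 35"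
  "opt_prog ex ! 32 = NLoad 10 7"
  "opt_prog ex ! 33 = QStore 10 5"
  "opt_prog ex ! 34 = Jump 30"
  by (simp_all add: opt_prog_def)

lemmas exec_simps = run_Suc run_numeral step_def halted_def length_opt_prog nth_opt_prog

text \<open>The registers that stay fixed once \<open>p * q\<close> is known. The zeros turn
  addition into copying; the rational 1 is the entry to be written.\<close>

definition const_regs :: "nat \<Rightarrow> nat \<Rightarrow> state \<Rightarrow> bool" where
  "const_regs p q s \<longleftrightarrow> nreg s 1 = q \<and> nreg s 2 = 0 \<and> nreg s 3 = 1 \<and> nreg s 4 = p * q \<and>
     nreg s 9 = p * q + p * q \<and> qreg s 5 = 1 \<and> qreg s 6 = 0"

section \<open>Correctness of the program\<close>

text \<open>The \<open>j\<close> leftmost cells are still unread, and \<open>y\<close> is the best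
  of all other slots. Reading from right to left leaves the entry of column 1 in rational register
  1, as needed for the value of row \<open>r\<close> as lead. \<open>s0\<close> is the state before
  the row is opened.\<close>

definition row_inv :: "bool \<Rightarrow> nat \<Rightarrow> nat \<Rightarrow> rmat \<Rightarrow> nat \<Rightarrow> state \<Rightarrow> nat \<Rightarrow> state \<Rightarrow> bool" where
  "row_inv ex p q c r s0 j s \<longleftrightarrow> pc s = 14 \<and> const_regs p q s \<and> j \<le> q \<and>
     nreg s 5 = r * q + j \<and> nreg s 6 = r * q \<and> nreg s 7 = nreg s0 7 \<and> nmem s = nmem s0 \<and>
     qreg s 2 = qreg s0 2 \<and> qreg s 3 = qreg s0 3 \<and> qmem s = input_mem p q c \<and>
     (j < q \<longrightarrow> qreg s 1 = input_mem p q c (r * q + j)) \<and>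
     (\<exists>y\<in>slots ex p q r. nreg s 8 = p * q + y \<and> qreg s 0 = input_mem p q c y \<and>
       (\<forall>z\<in>slots ex p q r - {r * q..<r * q + j}. input_mem p q c z \<le> input_mem p q c y))"

lemma row_inv_step:
  assumes "row_inv ex p q c r s0 (Suc j) s"
  shows "reaches (opt_prog ex) 7 (row_inv ex p q c r s0 j) s"
proof -
  let ?f = "input_mem p q c"
  obtain y where y: "y \<in> slots ex p q r" "nreg s 8 = p * q + y" "qreg s 0 = ?f y"
    "\<forall>z\<in>slots ex p q r - {r * q..<r * q + Suc j}. ?f z \<le> ?f y"
    using assms by (auto simp: row_inv_def)
  have j: "j < q" using assms by (simp add: row_inv_def)
  show ?thesis
  proof (cases "?f (r * q + j) \<le> ?f y")
    case True
    have "\<forall>z\<in>slots ex p q r - {r * q..<r * q + j}. ?f z \<le> ?f y"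
    proof
      fix z assume "z \<in> slots ex p q r - {r * q..<r * q + j}"
      then show "?f z \<le> ?f y" using y(4) True by (cases "z = r * q + j") auto
    qed
    then show ?thesis
      using assms y True j
      by (intro reachesI[of _ _ 4]) (auto simp: row_inv_def const_regs_def exec_simps)
  next
    case False
    have "\<forall>z\<in>slots ex p q r - {r * q..<r * q + j}. ?f z \<le> ?f (r * q + j)"
    proof
      fix z assume "z \<in> slots ex p q r - {r * q..<r * q + j}"
      then show "?f z \<le> ?f (r * q + j)" using y(4) False
        by (cases "z = r * q + j") (auto intro: order_trans[of _ "?f y"])
    qed
    moreover have "r * q + j \<in> slots ex p q r" using j by (simp add: slots_def)
    ultimately show ?thesis
      using assms y(3) False j
      by (intro reachesI[of _ _ 7]) (auto simp: row_inv_def const_regs_def exec_simps)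
  qed
qed

text \<open>Rows \<open>n\<close> to \<open>p - 1\<close> are done, and \<open>k\<close> is the best
  lead among \<open>n\<close> to \<open>p\<close>. If \<open>ex\<close>, the lead instead follows
  the scan, so that it ends as 0. Output addresses are stored at index \<open>r * q\<close>, which
  is available without multiplication.\<close>

definition scan_inv :: "bool \<Rightarrow> nat \<Rightarrow> nat \<Rightarrow> rmat \<Rightarrow> nat \<Rightarrow> (nat \<Rightarrow> nat) \<Rightarrow> nat \<Rightarrow> state \<Rightarrow> bool" where
  "scan_inv ex p q c n x k s \<longleftrightarrow> pc s = 9 \<and> const_regs p q s \<and> qmem s = input_mem p q c \<and>
     nreg s 5 = n * q \<and> nreg s 7 = k * q \<and> n \<le> k \<and> k \<le> p \<and>
     (\<forall>r\<in>{n..<p}. nmem s (r * q) = p * q + x r \<and>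
        is_arg_max (input_mem p q c) (\<lambda>a. a \<in> slots ex p q r) (x r)) \<and>
     qreg s 3 = (\<Sum>r\<in>{n..<p}. input_mem p q c (x r)) \<and>
     qreg s 2 = choice_value p q (input_mem p q c) k x \<and>
     (if ex then k = n
      else \<forall>k'\<in>{n..p}. choice_value p q (input_mem p q c) k' x
             \<le> choice_value p q (input_mem p q c) k x)"

lemma scan_inv_step:
  assumes q: "q \<ge> 1" and inv: "scan_inv ex p q c (Suc n) x k s"
  shows "reaches (opt_prog ex) (7 * q + 13) (\<lambda>s'. \<exists>x k. scan_inv ex p q c n x k s') s"
proof -
  let ?f = "input_mem p q c"
  have n: "n < p" using inv by (simp add: scan_inv_def)
  have 1: "reaches (opt_prog ex) 5 (row_inv ex p q c n s q) s"
  proof (cases ex)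
    case True
    \<comment> \<open>The initial candidate must be an allowed slot: the last cell of the row here,
      the empty row in the other case.\<close>
    have "n * q + (q - 1) \<in> slots ex p q n" using q by (auto simp: slots_def)
    then show ?thesis
      using inv q True
      by (intro reachesI[of _ _ 5])
        (auto simp: row_inv_def scan_inv_def const_regs_def exec_simps slots_def algebra_simps
          intro!: bexI[of _ "n * q + (q - 1)"])
  next
    case False
    then show ?thesis
      using inv q
      by (intro reachesI[of _ _ 5])
        (auto simp: row_inv_def scan_inv_def const_regs_def exec_simps slots_def algebra_simps)
  qed
  have 2: "reaches (opt_prog ex) (q * 7) (row_inv ex p q c n s 0) s'"
    if "row_inv ex p q c n s q s'" for s'
    using that by (rule reaches_loop[rotated]) (rule row_inv_step)
  have 3: "reaches (opt_prog ex) 8 (\<lambda>s'. \<exists>x k. scan_inv ex p q c n x k s') s'"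
    if row: "row_inv ex p q c n s 0 s'" for s'
  proof -
    obtain y where y: "y \<in> slots ex p q n" "nreg s' 8 = p * q + y" "qreg s' 0 = ?f y"
      "\<forall>z\<in>slots ex p q n. ?f z \<le> ?f y"
      using row by (auto simp: row_inv_def)
    define x' where "x' = x(n := y)"
    \<comment> \<open>The value of lead \<open>k'\<close> uses \<open>x\<close> only at rows after
      \<open>k'\<close>, so fixing \<open>x n\<close> now does not disturb the leads from
      \<open>n\<close> on.\<close>
    have x'_le: "choice_value p q ?f k' x' = choice_value p q ?f k' x" if "n \<le> k'" for k'
      using that by (auto simp: choice_value_def x'_def intro!: sum.cong)
    have x'_Suc: "(\<Sum>r\<in>{Suc n..<p}. ?f (x' r)) = qreg s 3"
      using inv by (auto simp: scan_inv_def x'_def intro!: sum.cong)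
    \<comment> \<open>Rational register 4 receives this value, since the sum in register 3 is read
      before row \<open>n\<close> is added to it.\<close>
    have value_n: "choice_value p q ?f n x' = ?f (n * q) + qreg s 3"
      using x'_Suc by (simp add: choice_value_def atLeastSucLessThan_greaterThanLessThan)
    have sum_n: "(\<Sum>r\<in>{n..<p}. ?f (x' r)) = qreg s 3 + ?f y"
      using x'_Suc n by (simp add: sum.atLeast_Suc_lessThan x'_def)
    have mem: "((nmem s)(n * q := p * q + y)) (r * q) = p * q + x' r \<and>
        is_arg_max ?f (\<lambda>a. a \<in> slots ex p q r) (x' r)" if "r \<in> {n..<p}" for r
    proof (cases "r = n")
      case True
      then show ?thesis using y by (auto simp: x'_def is_arg_max_def not_less)
    next
      case False
      \<comment> \<open>As \<open>q\<close> is positive, \<open>r * q\<close> and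
        \<open>n * q\<close> differ, so the store leaves the other rows alone.\<close>
      then show ?thesis using inv that q by (auto simp: scan_inv_def x'_def)
    qed
    have k: "Suc n \<le> k" "k \<le> p" "qreg s 2 = choice_value p q ?f k x'"
      using inv x'_le[of k] by (auto simp: scan_inv_def)
    have best: "choice_value p q ?f k' x' \<le> choice_value p q ?f k x'"
      if "\<not> ex" "k' \<in> {Suc n..p}" for k'
      using inv that x'_le[of k'] x'_le[of k] by (auto simp: scan_inv_def)
    have row': "pc s' = 14" "const_regs p q s'" "nreg s' 5 = n * q" "nreg s' 6 = n * q"
      "nreg s' 7 = k * q" "nmem s' = nmem s" "qreg s' 2 = choice_value p q ?f k x'"
      "qreg s' 3 = qreg s 3" "qmem s' = ?f" "qreg s' 1 = ?f (n * q)"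
      using row inv k q by (auto simp: row_inv_def scan_inv_def)
    show ?thesis
    proof (cases "\<not> ex \<and> choice_value p q ?f n x' \<le> choice_value p q ?f k x'")
      case True
      have "choice_value p q ?f k' x' \<le> choice_value p q ?f k x'" if "k' \<in> {n..p}" for k'
        using best[of k'] True that by (cases "k' = n") auto
      then have "scan_inv ex p q c n x' k (run (opt_prog ex) 5 s')"
        using row' True k mem y(2,3) sum_n value_n n
        by (simp add: scan_inv_def const_regs_def exec_simps)
      then show ?thesis by (intro reachesI[of _ _ 5]) auto
    next
      \<comment> \<open>If \<open>ex\<close>, both outcomes of the jump at address 24 lead to 25, so
        row \<open>n\<close> always becomes the lead.\<close>
      case False
      have "choice_value p q ?f k' x' \<le> choice_value p q ?f n x'" if "\<not> ex" "k' \<in> {n..p}" for k'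
        using best[of k'] False that by (cases "k' = n") auto
      then have "scan_inv ex p q c n x' n (run (opt_prog ex) 8 s')"
        using row' False mem y(2,3) sum_n value_n n
        by (auto simp: scan_inv_def const_regs_def exec_simps)
      then show ?thesis by (intro reachesI[of _ _ 8]) auto
    qed
  qed
  have "reaches (opt_prog ex) (5 + (q * 7 + 8))
      (\<lambda>s'. \<exists>x k. scan_inv ex p q c n x k s') s"
    by (rule reaches_trans[OF 1 reaches_trans[OF 2 3]])
  then show ?thesis by (rule reaches_mono) simp
qed

text \<open>Row \<open>m\<close> is the last one written and \<open>d\<close> rows remain. The case
  \<open>m = k = p\<close> is the zero matrix: its single write falls on cell
  \<open>2 * p * q\<close> behind the output, and truncated subtraction gives
  \<open>d = 0\<close>.\<close>

definition write_inv :: "nat \<Rightarrow> nat \<Rightarrow> rmat \<Rightarrow> (nat \<Rightarrow> nat) \<Rightarrow> nat \<Rightarrow> nat \<Rightarrow> state \<Rightarrow> bool" where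
  "write_inv p q c x k d s \<longleftrightarrow> pc s = 30 \<and> const_regs p q s \<and>
     (\<forall>r\<in>{k<..<p}. nmem s (r * q) = p * q + x r) \<and>
     (\<exists>m. nreg s 7 = m * q \<and> p - Suc m = d \<and> k \<le> m \<and> (m < p \<or> m = k) \<and>
       qmem s = (\<lambda>a. if a \<in> (+) (p * q) ` insert (k * q) (x ` {k<..<Suc m}) then 1
                     else input_mem p q c a))"

lemma write_inv_step:
  assumes q: "q \<ge> 1" and inv: "write_inv p q c x k (Suc d) s"
  shows "reaches (opt_prog ex) 5 (write_inv p q c x k d) s"
proof -
  obtain m where m: "nreg s 7 = m * q" "p - Suc m = Suc d" "k \<le> m"
    "qmem s = (\<lambda>a. if a \<in> (+) (p * q) ` insert (k * q) (x ` {k<..<Suc m}) then 1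
                     else input_mem p q c a)"
    using inv by (auto simp: write_inv_def)
  have "Suc m * q < p * q" using m q by (intro mult_strict_right_mono) auto
  then have lt: "\<not> p * q \<le> m * q + q" by simp
  have cell: "nmem s (m * q + q) = p * q + x (Suc m)"
    using inv m by (auto simp: write_inv_def add.commute dest!: bspec[of _ _ "Suc m"])
  have "{k<..<Suc (Suc m)} = insert (Suc m) {k<..<Suc m}" using m by auto
  then have "qmem (run (opt_prog ex) 5 s) =
     (\<lambda>a. if a \<in> (+) (p * q) ` insert (k * q) (x ` {k<..<Suc (Suc m)}) then 1
          else input_mem p q c a)"
    using inv m lt cell by (auto simp: write_inv_def const_regs_def exec_simps)
  moreover have "nreg (run (opt_prog ex) 5 s) 7 = Suc m * q" "pc (run (opt_prog ex) 5 s) = 30"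
    "const_regs p q (run (opt_prog ex) 5 s)" "nmem (run (opt_prog ex) 5 s) = nmem s"
    using inv m lt by (auto simp: write_inv_def const_regs_def exec_simps)
  ultimately have "write_inv p q c x k d (run (opt_prog ex) 5 s)"
    using inv m unfolding write_inv_def by (intro conjI exI[of _ "Suc m"]) auto
  then show ?thesis by (rule reachesI) simp
qed

lemma output_choice_matrix:
  assumes "\<And>a. a < p * q \<Longrightarrow> qmem s (p * q + a) = of_bool (a \<in> insert (k * q) (x ` {k<..<p}))"
  shows "output_matrix p q s = choice_matrix p q k x"
proof -
  have "qmem s (p * q + (i - 1) * q + (j - 1)) =
      of_bool ((i - 1) * q + (j - 1) \<in> insert (k * q) (x ` {k<..<p}))"
    if "i \<in> {1..p}" "j \<in> {1..q}" for i j
  proof -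
    have "(i - 1) * q + (j - 1) < p * q" using that by (intro address_less) auto
    then show ?thesis unfolding add.assoc by (rule assms)
  qed
  then show ?thesis
    unfolding output_matrix_def choice_matrix_def
    by (intro restrict_ext) (auto simp: positions_def)
qed

lemma reaches_finish:
  assumes p: "p \<ge> 1" and q: "q \<ge> 1" and inv: "scan_inv ex p q c 0 x k s"
  shows "reaches (opt_prog ex) (p * 5 + 5) (\<lambda>s. halted (opt_prog ex) s \<and>
    is_arg_max (objective p q c) (\<lambda>A. A \<in> max_matrices ex p q) (output_matrix p q s)) s"
proof -
  have 1: "reaches (opt_prog ex) 3 (write_inv p q c x k (p - Suc k)) s"
    using inv
    by (intro reachesI[of _ _ 3])
      (auto simp: scan_inv_def write_inv_def const_regs_def exec_simps fun_eq_iff add.commute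
        intro!: exI[of _ k])
  have 2: "reaches (opt_prog ex) ((p - Suc k) * 5) (write_inv p q c x k 0) s'"
    if "write_inv p q c x k (p - Suc k) s'" for s'
    using that by (rule reaches_loop[rotated]) (rule write_inv_step[OF q])
  have 3: "reaches (opt_prog ex) 2 (\<lambda>s. halted (opt_prog ex) s \<and>
    is_arg_max (objective p q c) (\<lambda>A. A \<in> max_matrices ex p q) (output_matrix p q s)) s'"
    if fin: "write_inv p q c x k 0 s'" for s'
  proof -
    obtain m where m: "nreg s' 7 = m * q" "p \<le> Suc m" "m < p \<or> m = k"
      "qmem s' = (\<lambda>a. if a \<in> (+) (p * q) ` insert (k * q) (x ` {k<..<Suc m}) then 1
                     else input_mem p q c a)"
      using fin by (auto simp: write_inv_def)
    have kp: "k \<le> p" using inv by (simp add: scan_inv_def)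
    have "p * q \<le> Suc m * q" using m by (intro mult_right_mono) auto
    then have le: "p * q \<le> m * q + q" by simp
    let ?t = "run (opt_prog ex) 2 s'"
    have t: "pc ?t = 35" "qmem ?t = qmem s'"
      using fin m le by (auto simp: write_inv_def const_regs_def exec_simps)
    \<comment> \<open>Either \<open>m = p - 1\<close>, or \<open>m = k = p\<close> and both
      intervals are empty.\<close>
    have "{k<..<Suc m} = {k<..<p}" using m kp by auto
    then have "output_matrix p q ?t = choice_matrix p q k x"
      by (intro output_choice_matrix) (auto simp: t m(4) input_mem_def)
    moreover have "is_arg_max (objective p q c) (\<lambda>A. A \<in> max_matrices ex p q) 
        (choice_matrix p q k x)"
      using inv by (intro is_arg_max_choice_matrix[OF p q])
        (auto simp: scan_inv_def leads_def split: if_splits)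
    ultimately show ?thesis
      using t by (intro reachesI[of _ _ 2]) (auto simp: halted_def length_opt_prog)
  qed
  have "reaches (opt_prog ex) (3 + ((p - Suc k) * 5 + 2)) (\<lambda>s. halted (opt_prog ex) s \<and>
    is_arg_max (objective p q c) (\<lambda>A. A \<in> max_matrices ex p q) (output_matrix p q s)) s"
    by (rule reaches_trans[OF 1 reaches_trans[OF 2 3]])
  then show ?thesis by (rule reaches_mono) simp
qed

text \<open>\<open>n\<close> copies of \<open>q\<close> are still to be added. Register 0 serves as
  the counter, so \<open>p\<close> itself is lost and the output loop stops by comparison with
  \<open>p * q\<close>.\<close>

definition mult_inv :: "nat \<Rightarrow> nat \<Rightarrow> rmat \<Rightarrow> nat \<Rightarrow> state \<Rightarrow> bool" where
  "mult_inv p q c n s \<longleftrightarrow> pc s = 2 \<and> nreg s 0 = n \<and> nreg s 1 = q \<and> nreg s 2 = 0 \<and> nreg s 3 = 1 \<and>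
     nreg s 4 + n * q = p * q \<and> qreg s 2 = 0 \<and> qreg s 3 = 0 \<and> qreg s 5 = 1 \<and> qreg s 6 = 0 \<and>
     qmem s = input_mem p q c"

lemma mult_inv_step:
  assumes "mult_inv p q c (Suc n) s"
  shows "reaches (opt_prog ex) 4 (mult_inv p q c n) s"
  using assms by (intro reachesI[of _ _ 4]) (auto simp: mult_inv_def exec_simps)

text \<open>No row has been scanned yet, so \<open>x\<close> is arbitrary and the lead is
  \<open>p\<close>, of value 0. If \<open>ex\<close>, this lead is only a placeholder, replaced once
  a row is closed.\<close>

lemma reaches_setup:
  "reaches (opt_prog ex) (p * 4 + 6) (scan_inv ex p q c p x p) (input_state p q c)"
proof -
  have 1: "reaches (opt_prog ex) 2 (mult_inv p q c p) (input_state p q c)"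
    by (intro reachesI[of _ _ 2])
      (auto simp: mult_inv_def input_state_def input_mem_def exec_simps)
  have 2: "reaches (opt_prog ex) (p * 4) (mult_inv p q c 0) s"
    if "mult_inv p q c p s" for s
    using that by (rule reaches_loop[rotated]) (rule mult_inv_step)
  have 3: "reaches (opt_prog ex) 4 (scan_inv ex p q c p x p) s"
    if "mult_inv p q c 0 s" for s
    using that by (intro reachesI[of _ _ 4])
      (auto simp: mult_inv_def scan_inv_def const_regs_def choice_value_def input_mem_def exec_simps)
  have "reaches (opt_prog ex) (2 + (p * 4 + 4)) (scan_inv ex p q c p x p)
      (input_state p q c)"
    by (rule reaches_trans[OF 1 reaches_trans[OF 2 3]])
  then show ?thesis by (rule reaches_mono) simp
qed

section \<open>The overall time bound\<close>

lemma solvable_max_matrices: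
  "linear_optimization_solvable_in_O (max_matrices ex) (\<lambda>p q. p * q)"
  unfolding linear_optimization_solvable_in_O_def
\<comment> \<open>The phases add up to \<open>7 * p * q + 22 * p + 11\<close>. Since
  \<open>p\<close> and 1 are at most \<open>p * q\<close>, the constant
  \<open>7 + 22 + 11 = 40\<close> suffices.\<close>
proof (rule exI[of _ "opt_prog ex"], rule exI[of _ 40], intro allI impI)
  fix p q :: nat and c :: rmat
  assume p: "p \<ge> 1" and q: "q \<ge> 1"
  let ?Q = "\<lambda>s. halted (opt_prog ex) s \<and>
    is_arg_max (objective p q c) (\<lambda>A. A \<in> max_matrices ex p q) (output_matrix p q s)"
  let ?I = "\<lambda>n s. \<exists>x k. scan_inv ex p q c n x k s"
  have 1: "reaches (opt_prog ex) (p * 4 + 6) (?I p) (input_state p q c)"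
    using reaches_setup[of ex p q c] unfolding reaches_def by blast
  have 2: "reaches (opt_prog ex) (p * (7 * q + 13)) (?I 0) s" if "?I p s" for s
    using that by (intro reaches_loop[where I = ?I]) (auto intro: scan_inv_step[OF q])
  have 3: "reaches (opt_prog ex) (p * 5 + 5) ?Q s" if "?I 0 s" for s
    using that reaches_finish[OF p q] by blast
  have "reaches (opt_prog ex) (p * 4 + 6 + (p * (7 * q + 13) + (p * 5 + 5))) ?Q
      (input_state p q c)"
    by (rule reaches_trans[OF 1 reaches_trans[OF 2 3]])
  moreover have "p * 4 + 6 + (p * (7 * q + 13) + (p * 5 + 5)) \<le> 40 * (p * q)"
  proof -
    have "p \<le> p * q" "1 \<le> p * q" using p q by auto
    moreover have "p * (7 * q + 13) = 7 * (p * q) + 13 * p" by (simp add: algebra_simps)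
    ultimately show ?thesis by linarith
  qed
  ultimately have "reaches (opt_prog ex) (40 * (p * q)) ?Q (input_state p q c)"
    by (rule reaches_mono)
  then show "\<exists>t\<le>40 * (p * q). halted (opt_prog ex) (run (opt_prog ex) t (input_state p q c)) \<and>
      is_arg_max (objective p q c) (\<lambda>A. A \<in> max_matrices ex p q)
        (output_matrix p q (run (opt_prog ex) t (input_state p q c)))"
    by (simp only: reaches_def)
qed

theorem theorem1:
  shows "linear_optimization_solvable_in_O max_at_most_one (\<lambda>p q. p * q) \<and>
         linear_optimization_solvable_in_O max_exactly_one (\<lambda>p q. p * q)"
  using solvable_max_matrices[of False] solvable_max_matrices[of True]
  by (simp add: max_matrices_def)

end
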